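(* The mechanism TwoExtreme, which maps every location profile $\mathbf x$ to the edge $(x_r,y_l)$, is group strategyproof and is a $\frac{2-2(1-k)L}{1+k-(1-k)L}$-approximation for the maximum cost, i.e. for every location profile $\mathbf x$, $$MC(x_r,y_l,\mathbf x)\le \frac{2-2(1-k)L}{1+k-(1-k)L}\cdot\min_{(a,b)}MC(a,b,\mathbf x),$$ the minimum being over all edges. When $L=0$ the ratio $\frac{2-2(1-k)L}{1+k-(1-k)L}$ becomes $\frac{2}{1+k}$; when $L=1$ (substituted formally, for $k>0$) it is $1$.
   Context: Setting. Fix a constant $k\in[0,1)$ and an obstacle $[o,o+L]$ with $o\in(0,1)$ and $0\le L<1-o$. Agents $N=\{1,\ldots,n\}$ have locations $x_i\in[0,o)\cup(o+L,1]$; $N_1=\{i: x_i<o\}$ and $N_2=\{i: x_i>o+L\}$, both nonempty. An edge is a pair $(a,b)$ with $a\in[0,o)$, $b\in(o+L,1]$. The cost of agent $i\in N_1$ is $cost(a,b,x_i)=|x_i-a|+k(b-a)+(1-b)$; the cost of agent $i\in N_2$ is $cost(a,b,x_i)=|x_i-b|+k(b-a)+a$. The maximum cost is $MC(a,b,\mathbf x)=\max_{i\in N}cost(a,b,x_i)$. Write $x_r=\max\{x_i: i\in N_1\}$ and $y_l=\min\{x_j: j\in N_2\}$. A mechanism $f$ maps location profiles to edges. It is group strategyproof if for every nonempty $S\subseteq N$, every profile $\mathbf x$ and every joint misreport $\mathbf x_S'$ of the agents in $S$ (each agent reporting a location in its own region), there is $i\in S$ with $cost(f(\mathbf x),x_i)\le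 cost(f(\mathbf x_S',\mathbf x_{-S}),x_i)$. *)

theory Defs
  imports Complex_Main "HOL-Library.FuncSet"
begin

text \<open>
  The obstacle is the interval from \<open>ob\<close> to \<open>ob + L\<close>. The agents are \<open>{1..n}\<close>, and a location
  profile is an extensional function on them, i.e. an honest \<open>n\<close>-tuple.
\<close>

definition left_region :: "real \<Rightarrow> real set" where
  "left_region ob = {0..<ob}"

definition right_region :: "real \<Rightarrow> real \<Rightarrow> real set" where
  "right_region ob L = {ob + L<..1}"

definition left_agents :: "nat \<Rightarrow> real \<Rightarrow> (nat \<Rightarrow> real) \<Rightarrow> nat set" where
  "left_agents n ob x = {i \<in> {1..n}. x i < ob}"

definition right_agents :: "nat \<Rightarrow> real \<Rightarrow> real \<Rightarrow> (nat \<Rightarrow> real) \<Rightarrow> nat set" where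
  "right_agents n ob L x = {i \<in> {1..n}. x i > ob + L}"

definition profiles :: "nat \<Rightarrow> real \<Rightarrow> real \<Rightarrow> (nat \<Rightarrow> real) set" where
  "profiles n ob L =
     {x \<in> {1..n} \<rightarrow>\<^sub>E (left_region ob \<union> right_region ob L).
        left_agents n ob x \<noteq> {} \<and> right_agents n ob L x \<noteq> {}}"

definition edges :: "real \<Rightarrow> real \<Rightarrow> (real \<times> real) set" where
  "edges ob L = left_region ob \<times> right_region ob L"

text \<open>
  The two branches are the costs of agents on the left and on the right of the obstacle; the test
  \<open>z < ob\<close> decides between them because \<open>z\<close> is never a point of the obstacle.
\<close>

definition cost :: "real \<Rightarrow> real \<Rightarrow> real \<times> real \<Rightarrow> real \<Rightarrow> real" where
  "cost k ob e z = (case e of (a, b) \<Rightarrow>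
     if z < ob then \<bar>z - a\<bar> + k * (b - a) + (1 - b)
     else \<bar>z - b\<bar> + k * (b - a) + a)"

definition max_cost :: "real \<Rightarrow> real \<Rightarrow> nat \<Rightarrow> real \<times> real \<Rightarrow> (nat \<Rightarrow> real) \<Rightarrow> real" where
  "max_cost k ob n e x = Max ((\<lambda>i. cost k ob e (x i)) ` {1..n})"

definition is_mechanism ::
  "nat \<Rightarrow> real \<Rightarrow> real \<Rightarrow> ((nat \<Rightarrow> real) \<Rightarrow> real \<times> real) \<Rightarrow> bool" where
  "is_mechanism n ob L f \<longleftrightarrow> (\<forall>x \<in> profiles n ob L. f x \<in> edges ob L)"

text \<open>
  In \<open>override_on x x' S\<close> the agents in \<open>S\<close> report \<open>x'\<close> and all others report \<open>x\<close>; the values of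
  \<open>x'\<close> outside \<open>S\<close> play no role.
\<close>

definition group_strategyproof ::
  "real \<Rightarrow> nat \<Rightarrow> real \<Rightarrow> real \<Rightarrow> ((nat \<Rightarrow> real) \<Rightarrow> real \<times> real) \<Rightarrow> bool" where
  "group_strategyproof k n ob L f \<longleftrightarrow>
     (\<forall>x \<in> profiles n ob L. \<forall>S x'.
        S \<noteq> {} \<and> S \<subseteq> {1..n} \<and>
        (\<forall>i \<in> S. x i \<in> left_region ob \<and> x' i \<in> left_region ob \<or>
                 x i \<in> right_region ob L \<and> x' i \<in> right_region ob L) \<longrightarrow>
        (\<exists>i \<in> S. cost k ob (f x) (x i) \<le> cost k ob (f (override_on x x' S)) (x i)))"

text \<open>
  The set of edges is not compact, so that the minimum of the maximum cost is attained is part of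
  the claim: the value is compared with that of an existing minimizer rather than with an infimum.
\<close>

definition is_approximation ::
  "real \<Rightarrow> nat \<Rightarrow> real \<Rightarrow> real \<Rightarrow> real \<Rightarrow> ((nat \<Rightarrow> real) \<Rightarrow> real \<times> real) \<Rightarrow> bool" where
  "is_approximation k n ob L \<rho> f \<longleftrightarrow>
     (\<forall>x \<in> profiles n ob L.
        \<exists>e. is_arg_min (\<lambda>e. max_cost k ob n e x) (\<lambda>e. e \<in> edges ob L) e \<and>
            max_cost k ob n (f x) x \<le> \<rho> * max_cost k ob n e x)"

definition two_extreme :: "nat \<Rightarrow> real \<Rightarrow> real \<Rightarrow> (nat \<Rightarrow> real) \<Rightarrow> real \<times> real" where
  "two_extreme n ob L x =
     (Max (x ` left_agents n ob x), Min (x ` right_agents n ob L x))"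

definition ratio :: "real \<Rightarrow> real \<Rightarrow> real" where
  "ratio k L = (2 - 2 * (1 - k) * L) / (1 + k - (1 - k) * L)"

end

theory Submission
  imports Defs "HOL-Analysis.Analysis"
begin

text \<open>
  Write \<open>w\<close> for the width \<open>b - a\<close> of an edge and \<open>d = y\<^sub>l - x\<^sub>r\<close>. The cost of a left agent at \<open>z\<close>
  is at least \<open>1 - z - (1 - k) w\<close>, with equality for \<open>TwoExtreme\<close>, so a coalition can gain only
  by widening the edge, which requires that it contains the agent at \<open>x\<^sub>r\<close> or at \<open>y\<^sub>l\<close>; whichever
  of these two endpoints moved farther belongs to an agent who does not gain.

  For the ratio, the costs of the agents at \<open>x\<^sub>r\<close> and \<open>y\<^sub>l\<close> average at least \<open>(1 - d) / 2 + k w\<close>.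
  Weighting this bound by \<open>1 - k\<close> and that of an agent who is worst off under \<open>TwoExtreme\<close> by \<open>k\<close>
  cancels \<open>w\<close> and bounds the maximum cost of every edge from below.
\<close>

section \<open>Bounds on the cost of a single agent\<close>

text \<open>These replace \<open>\<bar>z - a\<bar>\<close> by \<open>a - z\<close> and by
  \<open>z - a\<close>. The first depends on the edge only through its width; the second is sharp
  when \<open>a\<close> lies to the left of \<open>z\<close>.\<close>

lemma cost_left_ge:
  assumes "z < ob"
  shows "1 - z - (1 - k) * (b - a) \<le> cost k ob (a, b) z"
    and "1 + z - (1 + k) * a - (1 - k) * b \<le> cost k ob (a, b) z"
  using assms by (auto simp: cost_def algebra_simps)

lemma cost_right_ge:
  assumes "ob \<le> z"
  shows "z - (1 - k) * (b - a) \<le> cost k ob (a, b) z"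
    and "(1 + k) * b + (1 - k) * a - z \<le> cost k ob (a, b) z"
  using assms by (auto simp: cost_def algebra_simps)

lemma cost_left_eq:
  assumes "z < ob" "z \<le> a"
  shows "cost k ob (a, b) z = 1 - z - (1 - k) * (b - a)"
  using assms by (simp add: cost_def algebra_simps)

lemma cost_right_eq:
  assumes "ob \<le> z" "b \<le> z"
  shows "cost k ob (a, b) z = z - (1 - k) * (b - a)"
  using assms by (simp add: cost_def algebra_simps)

text \<open>Moving the endpoints outward by \<open>p\<close> and \<open>q\<close> saves
  \<open>p + q\<close> of walking, since a left agent is not right of \<open>r\<close> and a right
  agent not left of \<open>l\<close>, while the cost of the edge grows only by
  \<open>k * (p + q)\<close>.\<close>

lemma cost_clamp_le:
  assumes "k \<le> 1" and "z < ob \<and> z \<le> r \<or> ob \<le> z \<and> l \<le> z"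
  shows "cost k ob (min a r, max b l) z \<le> cost k ob (a, b) z"
proof -
  define p q where "p = a - min a r" and "q = max b l - b"
  have eqs: "min a r = a - p" "max b l = b + q" and "0 \<le> p" "0 \<le> q"
    by (auto simp: p_def q_def)
  have le: "k * (p + q) \<le> p + q"
    using mult_right_mono[of k 1 "p + q"] \<open>k \<le> 1\<close> \<open>0 \<le> p\<close> \<open>0 \<le> q\<close> by simp
  from assms(2) show ?thesis
  proof
    assume "z < ob \<and> z \<le> r"
    moreover from this have "\<bar>z - (a - p)\<bar> \<le> \<bar>z - a\<bar> - p"
      by (auto simp: p_def min_def)
    ultimately show ?thesis
      using le by (simp add: cost_def eqs algebra_simps)
  next
    assume "ob \<le> z \<and> l \<le> z"
    moreover from this have "\<bar>z - (b + q)\<bar> \<le> \<bar>z - b\<bar> - q"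
      by (auto simp: q_def max_def)
    ultimately show ?thesis
      using le by (simp add: cost_def eqs algebra_simps)
  qed
qed

lemma continuous_on_cost: "continuous_on A (\<lambda>e. cost k ob e z)"
  unfolding cost_def case_prod_beta
  by (cases "z < ob") (auto intro!: continuous_intros)

lemma continuous_on_Max_image:
  fixes f :: "'i \<Rightarrow> 'a::topological_space \<Rightarrow> 'b::linorder_topology"
  assumes "finite I" "I \<noteq> {}" "\<And>i. i \<in> I \<Longrightarrow> continuous_on A (f i)"
  shows "continuous_on A (\<lambda>x. Max ((\<lambda>i. f i x) ` I))"
  using assms
proof (induction I rule: finite_ne_induct)
  case (insert i I)
  then show ?case
    by (simp add: continuous_on_max)
qed simp

section \<open>Maximum cost, agents and extreme locations\<close>

lemma max_cost_le_iff:
  assumes "0 < n"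
  shows "max_cost k ob n e x \<le> c \<longleftrightarrow> (\<forall>i\<in>{1..n}. cost k ob e (x i) \<le> c)"
  using assms by (simp add: max_cost_def)

lemma cost_le_max_cost:
  assumes "i \<in> {1..n}"
  shows "cost k ob e (x i) \<le> max_cost k ob n e x"
  using assms by (simp add: max_cost_def)

lemma profile_agent_cases:
  assumes "x \<in> profiles n ob L" "i \<in> {1..n}"
  obtains "i \<in> left_agents n ob x" | "i \<in> right_agents n ob L x"
  using assms by (fastforce simp: profiles_def left_agents_def right_agents_def
      left_region_def right_region_def)

lemma left_agents_bounds:
  assumes "x \<in> profiles n ob L" "0 \<le> L" "i \<in> left_agents n ob x"
  shows "i \<in> {1..n}" "0 \<le> x i" "x i < ob"
  using assms by (auto simp: profiles_def left_agents_def
      left_region_def right_region_def dest!: PiE_mem)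

lemma right_agents_bounds:
  assumes "x \<in> profiles n ob L" "0 \<le> L" "i \<in> right_agents n ob L x"
  shows "i \<in> {1..n}" "ob + L < x i" "x i \<le> 1"
  using assms by (auto simp: profiles_def right_agents_def
      left_region_def right_region_def dest!: PiE_mem)

lemma finite_agents [simp]: "finite (left_agents n ob x)" "finite (right_agents n ob L x)"
  by (simp_all add: left_agents_def right_agents_def)

lemma two_extreme_witness:
  assumes "x \<in> profiles n ob L"
  obtains r l where "r \<in> left_agents n ob x" "l \<in> right_agents n ob L x"
    "two_extreme n ob L x = (x r, x l)"
    "\<And>i. i \<in> left_agents n ob x \<Longrightarrow> x i \<le> x r"
    "\<And>i. i \<in> right_agents n ob L x \<Longrightarrow> x l \<le> x i"
proof -
  have ne: "left_agents n ob x \<noteq> {}" "right_agents n ob L x \<noteq> {}"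
    using assms by (auto simp: profiles_def)
  have "Max (x ` left_agents n ob x) \<in> x ` left_agents n ob x"
    using ne by (intro Max_in) auto
  then obtain r where r: "r \<in> left_agents n ob x" "Max (x ` left_agents n ob x) = x r"
    by blast
  have "Min (x ` right_agents n ob L x) \<in> x ` right_agents n ob L x"
    using ne by (intro Min_in) auto
  then obtain l where l: "l \<in> right_agents n ob L x" "Min (x ` right_agents n ob L x) = x l"
    by blast
  show ?thesis
  proof (rule that[OF r(1) l(1)])
    show "x i \<le> x r" if "i \<in> left_agents n ob x" for i
      using that r(2) by (metis Max_ge finite_agents(1) finite_imageI imageI)
    show "x l \<le> x i" if "i \<in> right_agents n ob L x" for i
      using that l(2) by (metis Min_le finite_agents(2) finite_imageI imageI)
  qed (simp add: two_extreme_def r l)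
qed

lemma is_mechanism_two_extreme:
  assumes "0 \<le> L"
  shows "is_mechanism n ob L (two_extreme n ob L)"
  unfolding is_mechanism_def
proof
  fix x assume x: "x \<in> profiles n ob L"
  then obtain r l where "r \<in> left_agents n ob x" "l \<in> right_agents n ob L x"
    "two_extreme n ob L x = (x r, x l)"
    by (rule two_extreme_witness)
  then show "two_extreme n ob L x \<in> edges ob L"
    using left_agents_bounds[OF x assms] right_agents_bounds[OF x assms]
    by (simp add: edges_def left_region_def right_region_def)
qed

section \<open>Group strategyproofness\<close>

lemma group_strategyproof_two_extreme:
  assumes "0 \<le> k" "k < 1" "0 \<le> L"
  shows "group_strategyproof k n ob L (two_extreme n ob L)"
  unfolding group_strategyproof_def
proof (intro ballI allI impI)
  fix x S x'
  assume x: "x \<in> profiles n ob L"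
    and "S \<noteq> {} \<and> S \<subseteq> {1..n} \<and>
        (\<forall>i \<in> S. x i \<in> left_region ob \<and> x' i \<in> left_region ob \<or>
                 x i \<in> right_region ob L \<and> x' i \<in> right_region ob L)"
  then have S: "S \<noteq> {}" "S \<subseteq> {1..n}"
    and reg: "\<And>i. i \<in> S \<Longrightarrow> x i \<in> left_region ob \<and> x' i \<in> left_region ob \<or>
                 x i \<in> right_region ob L \<and> x' i \<in> right_region ob L"
    by auto
  define y where "y = override_on x x' S"
  have "y i < ob \<longleftrightarrow> x i < ob" "ob + L < y i \<longleftrightarrow> ob + L < x i" for i
    using reg[of i] \<open>0 \<le> L\<close>
    by (auto simp: y_def override_on_def left_region_def right_region_def)
  then have agents: "left_agents n ob y = left_agents n ob x"
      "right_agents n ob L y = right_agents n ob L x"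
    by (simp_all add: left_agents_def right_agents_def)
  obtain r l where r: "r \<in> left_agents n ob x" and l: "l \<in> right_agents n ob L x"
    and eq: "two_extreme n ob L x = (x r, x l)"
    and ler: "\<And>i. i \<in> left_agents n ob x \<Longrightarrow> x i \<le> x r"
    and lel: "\<And>i. i \<in> right_agents n ob L x \<Longrightarrow> x l \<le> x i"
    using two_extreme_witness[OF x] by metis
  note left = left_agents_bounds[OF x \<open>0 \<le> L\<close>] and right = right_agents_bounds[OF x \<open>0 \<le> L\<close>]
  define a b where "a = Max (y ` left_agents n ob x)" and "b = Min (y ` right_agents n ob L x)"
  have eq': "two_extreme n ob L y = (a, b)"
    by (simp add: two_extreme_def agents a_def b_def)
  have "y r \<le> a" "b \<le> y l"
    using r l by (auto simp: a_def b_def)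
  \<comment> \<open>An agent outside \<open>S\<close> reports truthfully and so keeps its endpoint
    from moving outward.\<close>
  then have moved: "a < x r \<Longrightarrow> r \<in> S" "x l < b \<Longrightarrow> l \<in> S"
    by (auto simp: y_def override_on_def split: if_splits)
  have "\<exists>i\<in>S. cost k ob (x r, x l) (x i) \<le> cost k ob (a, b) (x i)"
  proof (cases "b - a \<le> x l - x r")
    \<comment> \<open>Truthful costs meet the width-only lower bounds, so no member of
      \<open>S\<close> gains from an edge that is no wider; any member serves.\<close>
    case True
    then have le: "(1 - k) * (b - a) \<le> (1 - k) * (x l - x r)"
      using \<open>k < 1\<close> by (intro mult_left_mono) auto
    obtain i where i: "i \<in> S"
      using S by auto
    then have "i \<in> {1..n}"
      using S by auto
    with x have "cost k ob (x r, x l) (x i) \<le> cost k ob (a, b) (x i)"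
    proof (cases rule: profile_agent_cases)
      case 1
      then show ?thesis
        using cost_left_eq[of "x i" ob "x r" k "x l"] cost_left_ge(1)[of "x i" ob k b a] ler[of i] left[of i] le
        by linarith
    next
      case 2
      then show ?thesis
        using cost_right_eq[of ob "x i" "x l" k "x r"] cost_right_ge(1)[of ob "x i" k b a]
          lel[of i] right[of i] le \<open>0 \<le> L\<close>
        by linarith
    qed
    with i show ?thesis ..
  next
    \<comment> \<open>The outward moves \<open>x r - a\<close> and \<open>b - x l\<close> have a
      positive sum, so the larger one is positive and its agent lies in \<open>S\<close>.\<close>
    case False
    show ?thesis
    proof (cases "b - x l \<le> x r - a")
      case True
      then have "r \<in> S"
        using False by (intro moved) simp
      \<comment> \<open>Agent \<open>r\<close> loses at least
        \<open>(1 + k) * (x r - a) - (1 - k) * (b - x l)\<close>, which is at least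
        \<open>2 * k * (x r - a)\<close>.\<close>
      moreover have "(1 - k) * (b - x l) \<le> (1 - k) * (x r - a)" "0 \<le> k * (x r - a)"
        using True False \<open>0 \<le> k\<close> \<open>k < 1\<close> by (auto intro!: mult_left_mono mult_nonneg_nonneg)
      then have "cost k ob (x r, x l) (x r) \<le> cost k ob (a, b) (x r)"
        using cost_left_eq[of "x r" ob "x r" k "x l"] cost_left_ge(2)[of "x r" ob k a b] left[OF r]
        by (simp add: algebra_simps)
      ultimately show ?thesis ..
    next
      case b: False
      then have "l \<in> S"
        using False by (intro moved) simp
      moreover have "(1 - k) * (x r - a) \<le> (1 - k) * (b - x l)" "0 \<le> k * (b - x l)"
        using b False \<open>0 \<le> k\<close> \<open>k < 1\<close> by (auto intro!: mult_left_mono mult_nonneg_nonneg)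
      then have "cost k ob (x r, x l) (x l) \<le> cost k ob (a, b) (x l)"
        using cost_right_eq[of ob "x l" "x l" k "x r"] cost_right_ge(2)[of ob "x l" k b a]
          right[OF l] \<open>0 \<le> L\<close>
        by (simp add: algebra_simps)
      ultimately show ?thesis ..
    qed
  qed
  then show "\<exists>i\<in>S. cost k ob (two_extreme n ob L x) (x i)
      \<le> cost k ob (two_extreme n ob L (override_on x x' S)) (x i)"
    by (simp add: eq eq' flip: y_def)
qed

section \<open>Existence of an optimal edge\<close>

text \<open>A minimum exists on the compact rectangle \<open>K\<close>, which stays away from the
  open ends at the obstacle. By \<open>cost_clamp_le\<close>, clamping carries any edge into
  \<open>K\<close> without raising any agent's cost.\<close>

lemma max_cost_minimizer_exists:
  assumes "k \<le> 1" "0 \<le> L" and x: "x \<in> profiles n ob L"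
  shows "\<exists>e. is_arg_min (\<lambda>e. max_cost k ob n e x) (\<lambda>e. e \<in> edges ob L) e"
proof -
  obtain r l where r: "r \<in> left_agents n ob x" and l: "l \<in> right_agents n ob L x"
    and ler: "\<And>i. i \<in> left_agents n ob x \<Longrightarrow> x i \<le> x r"
    and lel: "\<And>i. i \<in> right_agents n ob L x \<Longrightarrow> x l \<le> x i"
    using two_extreme_witness[OF x] by metis
  note left = left_agents_bounds[OF x \<open>0 \<le> L\<close>] and right = right_agents_bounds[OF x \<open>0 \<le> L\<close>]
  have n: "0 < n"
    using left(1)[OF r] by simp
  define K where "K = {0..x r} \<times> {x l..1}"
  have "compact K"
    unfolding K_def by (intro compact_Times compact_Icc)
  moreover have "(x r, x l) \<in> K"
    using left[OF r] right[OF l] by (simp add: K_def)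
  moreover have "continuous_on K (\<lambda>e. max_cost k ob n e x)"
    unfolding max_cost_def using n
    by (intro continuous_on_Max_image continuous_on_cost) auto
  ultimately obtain e where e: "e \<in> K"
    and min: "\<And>e'. e' \<in> K \<Longrightarrow> max_cost k ob n e x \<le> max_cost k ob n e' x"
    using continuous_attains_inf[of K "\<lambda>e. max_cost k ob n e x"] by blast
  have "K \<subseteq> edges ob L"
    using left[OF r] right[OF l] by (auto simp: K_def edges_def left_region_def right_region_def)
  moreover have "max_cost k ob n e x \<le> max_cost k ob n (a, b) x" if "(a, b) \<in> edges ob L" for a b
  proof -
    have "(min a (x r), max b (x l)) \<in> K"
      using that left[OF r] right[OF l]
      by (auto simp: K_def edges_def left_region_def right_region_def)
    then have "max_cost k ob n e x \<le> max_cost k ob n (min a (x r), max b (x l)) x"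
      by (rule min)
    also have "\<dots> \<le> max_cost k ob n (a, b) x"
      unfolding max_cost_le_iff[OF n]
    proof
      fix i assume i: "i \<in> {1..n}"
      have "x i < ob \<and> x i \<le> x r \<or> ob \<le> x i \<and> x l \<le> x i"
        using x i
      proof (cases rule: profile_agent_cases)
        case 1
        then show ?thesis using left ler by blast
      next
        case 2
        then show ?thesis using right(2)[of i] lel \<open>0 \<le> L\<close> by auto
      qed
      then show "cost k ob (min a (x r), max b (x l)) (x i) \<le> max_cost k ob n (a, b) x"
        using cost_clamp_le[OF \<open>k \<le> 1\<close>] cost_le_max_cost[OF i] order_trans by blast
    qed
    finally show ?thesis .
  qed
  ultimately have "is_arg_min (\<lambda>e. max_cost k ob n e x) (\<lambda>e. e \<in> edges ob L) e"
    unfolding is_arg_min_linorder using e by auto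
  then show ?thesis ..
qed

section \<open>The approximation ratio\<close>

text \<open>
  The numbers \<open>m\<close>, \<open>w\<close> and \<open>s\<close> stand for the maximum cost of an edge, its width, and the distance
  from a worst-off agent to the end of the unit interval on its own side.
\<close>

lemma ratio_bound:
  fixes k L d s w m :: real
  assumes "0 \<le> k" "k < 1" "0 \<le> L" "L < 1" "L \<le> d" "0 \<le> s"
    and extremes: "1 - d + 2 * k * w \<le> 2 * m"
    and worst: "1 - s - (1 - k) * w \<le> m"
  shows "1 - s - (1 - k) * d \<le> ratio k L * m"
proof -
  define u v where "u = (1 - k) * L" and "v = (1 - k) * d"
  have "u \<le> v"
    unfolding u_def v_def using assms by (intro mult_left_mono) auto
  have "u \<le> 1 - k"
    unfolding u_def using assms mult_left_mono[of L 1 "1 - k"] by simp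
  have "u < 1"
    using mult_strict_right_mono[of "1 - k" 1 L] mult_left_le_one_le[of L "1 - k"] assms
    by (simp add: u_def)
  \<comment> \<open>The second weight is \<open>2 * k\<close> because \<open>extremes\<close> bounds
    \<open>2 * m\<close> whereas \<open>worst\<close> bounds \<open>m\<close>.\<close>
  have "(1 - k) * (1 - d + 2 * k * w) + 2 * k * (1 - s - (1 - k) * w) \<le> (1 - k) * (2 * m) + 2 * k * m"
    using assms by (intro add_mono mult_left_mono) auto
  then have m: "1 + k - v - 2 * k * s \<le> 2 * m"
    by (simp add: v_def algebra_simps)
  \<comment> \<open>The right side exceeds the left by exactly
    \<open>k * (v - u) + s * ((1 - k - u) + 2 * k * u)\<close>; both terms vanish at
    \<open>d = L\<close> and \<open>s = 0\<close>.\<close>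
  have "(1 + k - u) * (1 - s - v) \<le> (1 - u) * (1 + k - v - 2 * k * s)"
  proof -
    have "0 \<le> k * (v - u)"
      using assms \<open>u \<le> v\<close> by simp
    moreover have "0 \<le> s * ((1 - k - u) + 2 * k * u)"
      using assms \<open>u \<le> 1 - k\<close> by (simp add: u_def)
    ultimately show ?thesis
      by (simp add: algebra_simps)
  qed
  also have "\<dots> \<le> (1 - u) * (2 * m)"
    using m \<open>u < 1\<close> by (intro mult_left_mono) auto
  finally have "(1 + k - u) * (1 - s - v) \<le> (2 - 2 * u) * m"
    by (simp add: algebra_simps)
  moreover have "0 < 1 + k - u"
    using \<open>u < 1\<close> \<open>0 \<le> k\<close> by simp
  ultimately have "1 - s - v \<le> (2 - 2 * u) * m / (1 + k - u)"
    by (simp add: pos_le_divide_eq mult.commute)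
  then show ?thesis
    by (simp add: ratio_def u_def v_def algebra_simps)
qed

text \<open>Under \<open>TwoExtreme\<close> every agent pays \<open>1 - s - (1 - k) * d\<close>,
  with \<open>s = x i\<close> on the left and \<open>s = 1 - x i\<close> on the right, so
  \<open>ratio_bound\<close> applies to each agent separately.\<close>

lemma is_approximation_two_extreme:
  assumes "0 \<le> k" "k < 1" "0 \<le> L" "L < 1"
  shows "is_approximation k n ob L (ratio k L) (two_extreme n ob L)"
  unfolding is_approximation_def
proof
  fix x assume x: "x \<in> profiles n ob L"
  obtain a b where ab: "is_arg_min (\<lambda>e. max_cost k ob n e x) (\<lambda>e. e \<in> edges ob L) (a, b)"
    using max_cost_minimizer_exists[of k L x n ob] assms x by auto
  define m where "m = max_cost k ob n (a, b) x"
  obtain r l where r: "r \<in> left_agents n ob x" and l: "l \<in> right_agents n ob L x"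
    and eq: "two_extreme n ob L x = (x r, x l)"
    and ler: "\<And>i. i \<in> left_agents n ob x \<Longrightarrow> x i \<le> x r"
    and lel: "\<And>i. i \<in> right_agents n ob L x \<Longrightarrow> x l \<le> x i"
    using two_extreme_witness[OF x] by metis
  note left = left_agents_bounds[OF x \<open>0 \<le> L\<close>] and right = right_agents_bounds[OF x \<open>0 \<le> L\<close>]
  have n: "0 < n"
    using left(1)[OF r] by simp
  have ge: "cost k ob (a, b) (x i) \<le> m" if "i \<in> {1..n}" for i
    unfolding m_def using that by (rule cost_le_max_cost)
  have d: "L \<le> x l - x r"
    using left[OF r] right[OF l] by simp
  \<comment> \<open>Adding the second lower bounds for \<open>r\<close> and \<open>l\<close> leaves
    \<open>a\<close> and \<open>b\<close> only in the term \<open>2 * k * (b - a)\<close>.\<close>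
  have extremes: "1 - (x l - x r) + 2 * k * (b - a) \<le> 2 * m"
    using cost_left_ge(2)[of "x r" ob k a b] cost_right_ge(2)[of ob "x l" k b a]
      ge[of r] ge[of l] left[OF r] right[OF l] \<open>0 \<le> L\<close>
    by (simp add: algebra_simps)
  have "max_cost k ob n (two_extreme n ob L x) x \<le> ratio k L * m"
    unfolding max_cost_le_iff[OF n] eq
  proof
    fix i assume i: "i \<in> {1..n}"
    show "cost k ob (x r, x l) (x i) \<le> ratio k L * m"
      using x i
    proof (cases rule: profile_agent_cases)
      case 1
      then have "1 - x i - (1 - k) * (b - a) \<le> m"
        using cost_left_ge(1)[of "x i" ob k b a] ge[OF i] left[of i] by simp
      then have "1 - x i - (1 - k) * (x l - x r) \<le> ratio k L * m"
        using left(2)[OF 1] by (intro ratio_bound[OF assms d _ extremes])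
      then show ?thesis
        using cost_left_eq[of "x i" ob "x r" k "x l"] left[OF 1] ler[OF 1] by simp
    next
      case 2
      \<comment> \<open>Left unsimplified to match \<open>ratio_bound\<close> with
        \<open>s = 1 - x i\<close>.\<close>
      then have "1 - (1 - x i) - (1 - k) * (b - a) \<le> m"
        using cost_right_ge(1)[of ob "x i" k b a] ge[OF i] right[of i] \<open>0 \<le> L\<close> by simp
      then have "1 - (1 - x i) - (1 - k) * (x l - x r) \<le> ratio k L * m"
        using right(3)[OF 2] by (intro ratio_bound[OF assms d _ extremes]) auto
      then show ?thesis
        using cost_right_eq[of ob "x i" "x l" k "x r"] right[OF 2] lel[OF 2] \<open>0 \<le> L\<close> by simp
    qed
  qed
  with ab show "\<exists>e. is_arg_min (\<lambda>e. max_cost k ob n e x) (\<lambda>e. e \<in> edges ob L) e \<and>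
      max_cost k ob n (two_extreme n ob L x) x \<le> ratio k L * max_cost k ob n e x"
    unfolding m_def by blast
qed

theorem theorem4:
  fixes k ob L :: real and n :: nat
  assumes "0 \<le> k" and "k < 1"
    and "0 < ob" and "ob < 1"
    and "0 \<le> L" and "L < 1 - ob"
  shows "is_mechanism n ob L (two_extreme n ob L) \<and>
    group_strategyproof k n ob L (two_extreme n ob L) \<and>
    is_approximation k n ob L (ratio k L) (two_extreme n ob L) \<and>
    ratio k 0 = 2 / (1 + k) \<and>
    (0 < k \<longrightarrow> ratio k 1 = 1)"
  using assms
  \<comment> \<open>At \<open>L = 1\<close> the ratio is \<open>2 * k / (2 * k)\<close>, which for
    \<open>k = 0\<close> would be \<open>0 / 0 = 0\<close>.\<close>
  by (auto simp: is_mechanism_two_extreme group_strategyproof_two_extreme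
      is_approximation_two_extreme) (simp_all add: ratio_def)

end
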